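(* Assume that the function $f: D \to \mathbb{R}$ is eight times continuously differentiable on an interval $D \subset \mathbb{R}$ and has a simple zero $x^{*} \in D$. Moreover, let the real weight function $H$ of one real variable be one time continuously differentiable, and suppose that $$H(0)=1, \qquad H'(0)=2.$$ Consider the iteration, for $n = 0, 1, 2, \ldots$, starting from $x_0$: $$y_n = x_n - \frac{f(x_n)}{f'(x_n)},$$ $$z_n = x_n + \frac{1}{f'(x_n)}\left(\frac{f(x_n)^2}{f(y_n)-f(x_n)} - \frac{f(y_n)^2}{f(x_n)}\right),$$ $$x_{n+1} = z_n - \frac{f(z_n)}{f'(x_n)}\, F(x_n,y_n,z_n)\, H(s_n),$$ where $s_n = \dfrac{f(z_n)}{f(x_n)}$ and $$F(x_n,y_n,z_n) = \frac{f(y_n)^3\bigl(f(x_n)-10 f(y_n)\bigr) + 4 f(x_n)^2\bigl(f(y_n)^2 + f(x_n) f(y_n)\bigr)}{f(x_n)\bigl(2 f(x_n)-f(y_n)\bigr)^2\bigl(f(y_n)-f(z_n)\bigr)}.$$ If the initial approximation $x_0$ is sufficiently close to $x^{*}$, then the sequence $(x_n)$ converges to $x^{*}$ and the order of convergence is eight, with the error equation $$e_{n+1} = \left(\frac{1}{2}\, c_2^2\,(4c_2^2 - c_3)\,(c_2^3 - 8 c_2 c_3 + 2 c_4)\right) e_n^8 + O(e_n^9),$$ where $e_n = x_n - x^{*}$ and $c_k = \dfrac{f^{(k)}(x^{*})}{k!\, f'(x^{*})}$ for $k \in \mathbb{N}$.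
   Context: A simple zero $x^{*}$ of $f$ is a point with $f(x^{*})=0$ and $f'(x^{*}) \neq 0$. Powers such as $f(x_n)^2$ denote powers of the value $f(x_n)$ (not iterated composition). The order of convergence being eight is understood in the sense of the error equation: the error $e_{n+1}$ equals a constant (depending on $f$ at $x^{*}$) times $e_n^8$ plus $O(e_n^9)$.
   Formalization: It is additionally assumed that H(s) = H(0) + H'(0)s + O(s²) as s → 0, since the claim fails for merely continuously differentiable H (e.g. H(s) = 1+2s+|s|^{7/6}, f(x) = x+x²), and that x* lies in the interior of D. *)

theory Defs
  imports "HOL-Analysis.Analysis" "HOL-Library.Landau_Symbols"
begin

(* g k is the k-th derivative of f on D, one-sided at an end point of D that belongs to D.
   On an interval with nonempty interior g is determined by f, and g k agrees with
   (deriv ^^ k) f at interior points. *)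
definition C_k_on :: "nat \<Rightarrow> (real \<Rightarrow> real) \<Rightarrow> real set \<Rightarrow> bool" where
  "C_k_on m f D \<longleftrightarrow>
     (\<exists>g. (\<forall>x\<in>D. g 0 x = f x) \<and>
          (\<forall>k<m. \<forall>x\<in>D. (g k has_real_derivative g (Suc k) x) (at x within D)) \<and>
          (\<forall>k\<le>m. continuous_on D (g k)))"

definition simple_zero :: "(real \<Rightarrow> real) \<Rightarrow> real \<Rightarrow> bool" where
  "simple_zero f a \<longleftrightarrow> f a = 0 \<and> deriv f a \<noteq> 0"

definition err_coeff :: "(real \<Rightarrow> real) \<Rightarrow> real \<Rightarrow> nat \<Rightarrow> real" where
  "err_coeff f a k = (deriv ^^ k) f a / (fact k * deriv f a)"

definition weight_F :: "(real \<Rightarrow> real) \<Rightarrow> real \<Rightarrow> real \<Rightarrow> real \<Rightarrow> real" where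
  "weight_F f x y z =
     (f y ^ 3 * (f x - 10 * f y) + 4 * f x ^ 2 * (f y ^ 2 + f x * f y)) /
     (f x * (2 * f x - f y) ^ 2 * (f y - f z))"

definition is_iteration ::
  "(real \<Rightarrow> real) \<Rightarrow> (real \<Rightarrow> real) \<Rightarrow> (nat \<Rightarrow> real) \<Rightarrow> (nat \<Rightarrow> real) \<Rightarrow> (nat \<Rightarrow> real) \<Rightarrow> bool"
where
  "is_iteration f H x y z \<longleftrightarrow>
     (\<forall>n. y n = x n - f (x n) / deriv f (x n) \<and>
          z n = x n + 1 / deriv f (x n) *
                  (f (x n) ^ 2 / (f (y n) - f (x n)) - f (y n) ^ 2 / f (x n)) \<and>
          x (Suc n) = z n - f (z n) / deriv f (x n) *
                        weight_F f (x n) (y n) (z n) * H (f (z n) / f (x n)))"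

(* No denominator of an iteration step vanishes, so that the convention a / 0 = 0 is not used. *)
definition step_defined :: "(real \<Rightarrow> real) \<Rightarrow> real \<Rightarrow> real \<Rightarrow> real \<Rightarrow> bool" where
  "step_defined f x y z \<longleftrightarrow>
     deriv f x \<noteq> 0 \<and> f x \<noteq> 0 \<and> f y \<noteq> f x \<and> 2 * f x \<noteq> f y \<and> f y \<noteq> f z"

end

theory Submission
  imports Defs
begin

text \<open>
  Dividing by \<open>f' xstar\<close> and by the error \<open>e\<close>, all quantities of one step become functions of \<open>e\<close>
  with an expansion up to \<open>O(e\<^sup>5)\<close>. The new error factors as \<open>e * g * q * r\<close>: here \<open>e * g\<close> is the error
  of the Newton step, with \<open>g = c 2 * e + O(e\<^sup>2)\<close>, the second substep multiplies it by
  \<open>q = (4 * c 2 ^ 2 - c 3) * e\<^sup>2 + O(e\<^sup>3)\<close>, and the third one by \<open>r\<close>. The coefficients of \<open>r\<close> cancel below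
  degree 4, and the error constant is the product of the three leading coefficients. Working with
  the factors separately is what makes so short an expansion of \<open>f\<close> sufficient.
\<close>

unbundle no vec_syntax and fps_syntax

section \<open>Asymptotic expansions at the origin\<close>

text \<open>Only the coefficients of \<open>F\<close> below degree \<open>n\<close> matter, and
  \<open>f 0\<close> is unconstrained because the filter \<open>at 0\<close> is punctured. Carrying
  a whole formal power series makes ring operations and quotients available on the formal
  side.\<close>

definition expands :: "nat \<Rightarrow> (real \<Rightarrow> real) \<Rightarrow> real fps \<Rightarrow> bool" where
  "expands n f F \<longleftrightarrow> (\<lambda>x. f x - (\<Sum>k<n. F $ k * x ^ k)) \<in> O[at 0](\<lambda>x. x ^ n)"

lemma bigo_power_mono:
  assumes "m \<le> n"
  shows "(\<lambda>x::real. x ^ n) \<in> O[at 0](\<lambda>x. x ^ m)"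
proof (rule landau_o.bigI[of 1])
  have "eventually (\<lambda>x::real. \<bar>x\<bar> < 1) (at 0)"
    by (rule order_tendstoD) (auto intro!: tendsto_eq_intros)
  then show "eventually (\<lambda>x::real. norm (x ^ n) \<le> 1 * norm (x ^ m)) (at 0)"
  proof eventually_elim
    case (elim x)
    then show ?case
      using power_decreasing[OF assms, of "\<bar>x\<bar>"] by (simp add: power_abs)
  qed
qed simp

lemma expands_polynomial: "expands n (\<lambda>x. \<Sum>k<n. F $ k * x ^ k) F"
  by (simp add: expands_def)

lemma expands_bigo_diff:
  assumes "expands n f F" "(\<lambda>x. g x - f x) \<in> O[at 0](\<lambda>x. x ^ n)"
  shows "expands n g F"
  using sum_in_bigo(1)[OF assms[unfolded expands_def]] by (simp add: expands_def)

lemma expands_const: "n > 0 \<Longrightarrow> expands n (\<lambda>_. c) (fps_const c)"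
proof -
  assume "n > 0"
  then have "(\<Sum>k<n. fps_const c $ k * x ^ k) = c" for x
    by (subst sum.remove[of _ 0]) auto
  then show ?thesis by (simp add: expands_def)
qed

lemma expands_add:
  assumes "expands n f F" "expands n g G"
  shows "expands n (\<lambda>x. f x + g x) (F + G)"
  using sum_in_bigo(1)[OF assms[unfolded expands_def]]
  by (simp add: expands_def ring_distribs sum.distrib algebra_simps)

lemma expands_diff:
  assumes "expands n f F" "expands n g G"
  shows "expands n (\<lambda>x. f x - g x) (F - G)"
  using sum_in_bigo(2)[OF assms[unfolded expands_def]]
  by (simp add: expands_def ring_distribs sum_subtractf algebra_simps)

lemma expands_tendsto:
  assumes "expands n f F" "n > 0"
  shows "(f \<longlongrightarrow> F $ 0) (at 0)"
proof -
  have "((\<lambda>x::real. x ^ n / 1) \<longlongrightarrow> 0) (at 0)"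
    using assms(2) by (auto intro!: tendsto_eq_intros)
  then have "(\<lambda>x::real. x ^ n) \<in> o[at 0](\<lambda>_. 1)"
    by (intro smalloI_tendsto) auto
  then have "(\<lambda>x. f x - (\<Sum>k<n. F $ k * x ^ k)) \<in> o[at 0](\<lambda>_. 1)"
    using assms(1) landau_o.big_small_trans unfolding expands_def by blast
  then have "((\<lambda>x. f x - (\<Sum>k<n. F $ k * x ^ k)) \<longlongrightarrow> 0) (at 0)"
    by (auto dest: smalloD_tendsto)
  moreover have "((\<lambda>x. \<Sum>k<n. F $ k * x ^ k) \<longlongrightarrow> (\<Sum>k<n. F $ k * 0 ^ k)) (at 0)"
    by (intro tendsto_intros)
  moreover have "(\<Sum>k<n. F $ k * 0 ^ k) = F $ 0"
    using assms(2) by (subst sum.remove[of _ 0]) auto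
  ultimately show ?thesis
    using tendsto_add by fastforce
qed

lemma expands_bounded:
  assumes "expands n f F"
  shows "f \<in> O[at 0](\<lambda>_. 1)"
proof (cases "n = 0")
  case True
  then show ?thesis using assms by (simp add: expands_def)
next
  case False
  then show ?thesis using expands_tendsto[OF assms] by (intro bigoI_tendsto[where c = "F $ 0"]) auto
qed

text \<open>With truncations \<open>p\<close> and \<open>q\<close>, the error is
  \<open>(f - p) * g + p * (g - q)\<close> plus the difference between \<open>p * q\<close> and the
  truncated product. The first two terms are a remainder times a bounded function; the last consists
  of the terms with \<open>i + j \<ge> n\<close>.\<close>

lemma expands_mult:
  assumes "expands n f F" "expands n g G"
  shows "expands n (\<lambda>x. f x * g x) (F * G)"
proof -
  define p where "p = (\<lambda>x. \<Sum>k<n. F $ k * x ^ k)"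
  define q where "q = (\<lambda>x. \<Sum>k<n. G $ k * x ^ k)"
  have "(\<lambda>x. (f x - p x) * g x) \<in> O[at 0](\<lambda>x. x ^ n * 1)"
    using assms expands_bounded[OF assms(2)] unfolding expands_def p_def by (intro landau_o.big.mult) auto
  moreover have "(\<lambda>x. p x * (g x - q x)) \<in> O[at 0](\<lambda>x. 1 * x ^ n)"
    using assms(2) expands_bounded[OF expands_polynomial[of n F]]
    unfolding expands_def p_def q_def by (intro landau_o.big.mult) auto
  moreover have "(\<lambda>x. p x * q x - (\<Sum>k<n. (F * G) $ k * x ^ k)) \<in> O[at 0](\<lambda>x. x ^ n)"
  proof -
    define T where "T = {(i, j). i + j < n}"
    have sub: "T \<subseteq> {..<n} \<times> {..<n}"
      by (auto simp: T_def)
    have "p x * q x - (\<Sum>k<n. (F * G) $ k * x ^ k) =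
        (\<Sum>(i, j)\<in>{..<n} \<times> {..<n} - T. F $ i * G $ j * x ^ (i + j))" for x
    proof -
      have "p x * q x = (\<Sum>(i, j)\<in>{..<n} \<times> {..<n}. F $ i * G $ j * x ^ (i + j))"
        by (simp add: p_def q_def sum_product sum.cartesian_product power_add mult_ac)
      moreover have "(\<Sum>k<n. (F * G) $ k * x ^ k) = (\<Sum>(i, j)\<in>T. F $ i * G $ j * x ^ (i + j))"
        unfolding T_def by (subst sum.triangle_reindex)
          (simp add: fps_mult_nth sum_distrib_right atLeast0AtMost)
      ultimately show ?thesis
        by (simp add: sum_diff[OF _ sub])
    qed
    moreover have "(\<lambda>x. \<Sum>(i, j)\<in>{..<n} \<times> {..<n} - T. F $ i * G $ j * x ^ (i + j))
        \<in> O[at 0](\<lambda>x. x ^ n)"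
    proof (rule big_sum_in_bigo)
      fix ij assume ij: "ij \<in> {..<n} \<times> {..<n} - T"
      then show "(\<lambda>x. case ij of (i, j) \<Rightarrow> F $ i * G $ j * x ^ (i + j)) \<in> O[at 0](\<lambda>x. x ^ n)"
        by (cases ij) (auto simp: T_def intro!: bigo_power_mono)
    qed
    ultimately show ?thesis by simp
  qed
  ultimately have "(\<lambda>x. (f x - p x) * g x + p x * (g x - q x) +
      (p x * q x - (\<Sum>k<n. (F * G) $ k * x ^ k))) \<in> O[at 0](\<lambda>x. x ^ n)"
    by (simp only: sum_in_bigo mult_1_left mult_1_right)
  then show ?thesis
    by (simp add: expands_def algebra_simps)
qed

text \<open>The truncation \<open>p\<close> of \<open>inverse G\<close> satisfies
  \<open>p * g = 1 + O(x ^ n)\<close>. Multiplying by the bounded function \<open>1 / g\<close>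
  turns this into an expansion of \<open>1 / g\<close>.\<close>

lemma expands_divide:
  assumes f: "expands n f F" and g: "expands n g G" and "G $ 0 \<noteq> 0" "n > 0"
  shows "expands n (\<lambda>x. f x / g x) (F / G)"
proof -
  define p where "p = (\<lambda>x. \<Sum>k<n. inverse G $ k * x ^ k)"
  have lim: "(g \<longlongrightarrow> G $ 0) (at 0)"
    using expands_tendsto[OF g] \<open>n > 0\<close> .
  then have inv: "(\<lambda>x. inverse (g x)) \<in> O[at 0](\<lambda>_. 1)"
    using \<open>G $ 0 \<noteq> 0\<close> by (intro bigoI_tendsto[where c = "inverse (G $ 0)"]) (auto intro!: tendsto_intros)
  have "expands n (\<lambda>x. p x * g x) (inverse G * G)"
    unfolding p_def by (intro expands_mult expands_polynomial g)
  then have "expands n (\<lambda>x. p x * g x) (fps_const 1)"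
    using \<open>G $ 0 \<noteq> 0\<close> by (simp add: inverse_mult_eq_1)
  from expands_diff[OF this expands_const[OF \<open>n > 0\<close>, of 1]]
  have "(\<lambda>x. p x * g x - 1) \<in> O[at 0](\<lambda>x. x ^ n)"
    by (simp add: expands_def)
  then have "(\<lambda>x. (p x * g x - 1) * inverse (g x)) \<in> O[at 0](\<lambda>x. x ^ n * 1)"
    using inv by (rule landau_o.big.mult)
  moreover have "eventually (\<lambda>x. (p x * g x - 1) * inverse (g x) = p x - inverse (g x)) (at 0)"
    using tendsto_imp_eventually_ne[OF lim \<open>G $ 0 \<noteq> 0\<close>] by eventually_elim (simp add: field_simps)
  ultimately have "(\<lambda>x. p x - inverse (g x)) \<in> O[at 0](\<lambda>x. x ^ n)"
    by (simp add: landau_o.big.in_cong)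
  then have "(\<lambda>x. inverse (g x) - p x) \<in> O[at 0](\<lambda>x. x ^ n)"
    by (subst landau_o.big.uminus_in_iff[symmetric]) simp
  then have "expands n (\<lambda>x. inverse (g x)) (inverse G)"
    using expands_bigo_diff[OF expands_polynomial] by (simp add: p_def)
  from expands_mult[OF f this] show ?thesis
    using \<open>G $ 0 \<noteq> 0\<close> by (simp add: divide_inverse fps_divide_unit)
qed

lemma expands_leading_term:
  assumes "expands n f F" "k < n" "\<And>i. i < k \<Longrightarrow> F $ i = 0"
  shows "(\<lambda>x. f x - F $ k * x ^ k) \<in> O[at 0](\<lambda>x. x ^ Suc k)"
proof -
  have eq: "(\<Sum>i<n. F $ i * x ^ i) = F $ k * x ^ k + (\<Sum>i\<in>{Suc k..<n}. F $ i * x ^ i)" for x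
  proof -
    have "(\<Sum>i<n. F $ i * x ^ i) = (\<Sum>i\<in>{k..<n}. F $ i * x ^ i)"
      using assms(3) by (intro sum.mono_neutral_right) (auto simp: not_le)
    then show ?thesis using assms(2) by (simp add: sum.atLeast_Suc_lessThan)
  qed
  have "(\<lambda>x. f x - (\<Sum>i<n. F $ i * x ^ i)) \<in> O[at 0](\<lambda>x. x ^ Suc k)"
    using assms(1,2) landau_o.big_trans[OF _ bigo_power_mono[of "Suc k" n]] by (simp add: expands_def)
  moreover have "(\<lambda>x. \<Sum>i\<in>{Suc k..<n}. F $ i * x ^ i) \<in> O[at 0](\<lambda>x. x ^ Suc k)"
    by (intro big_sum_in_bigo) (auto intro!: bigo_power_mono simp del: power_Suc)
  ultimately have "(\<lambda>x. (f x - (\<Sum>i<n. F $ i * x ^ i)) + (\<Sum>i\<in>{Suc k..<n}. F $ i * x ^ i))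
      \<in> O[at 0](\<lambda>x. x ^ Suc k)"
    by (rule sum_in_bigo)
  then show ?thesis by (simp add: eq)
qed

lemma leading_term_bigo:
  assumes "(\<lambda>x. f x - a * x ^ k) \<in> O[at 0](\<lambda>x. x ^ Suc k)"
  shows "f \<in> O[at 0](\<lambda>x::real. x ^ k)"
proof -
  have "(\<lambda>x. f x - a * x ^ k) \<in> O[at 0](\<lambda>x. x ^ k)"
    using landau_o.big_trans[OF assms bigo_power_mono[of k "Suc k"]] by simp
  from sum_in_bigo(1)[OF this, of "\<lambda>x. a * x ^ k"] show ?thesis by simp
qed

text \<open>Orders add up when leading terms are multiplied, so a product is known to an order
  beyond the precision of the expansions of its factors.\<close>

lemma leading_term_mult:
  assumes f: "(\<lambda>x. f x - a * x ^ k) \<in> O[at 0](\<lambda>x. x ^ Suc k)"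
    and g: "(\<lambda>x. g x - b * x ^ l) \<in> O[at 0](\<lambda>x::real. x ^ Suc l)"
  shows "(\<lambda>x. f x * g x - (a * b) * x ^ (k + l)) \<in> O[at 0](\<lambda>x. x ^ Suc (k + l))"
proof -
  have "(\<lambda>x. (f x - a * x ^ k) * g x) \<in> O[at 0](\<lambda>x. x ^ Suc k * x ^ l)"
    using f leading_term_bigo[OF g] by (rule landau_o.big.mult)
  moreover have "(\<lambda>x. (a * x ^ k) * (g x - b * x ^ l)) \<in> O[at 0](\<lambda>x. x ^ k * x ^ Suc l)"
    using g by (intro landau_o.big.mult) auto
  ultimately have "(\<lambda>x. (f x - a * x ^ k) * g x + (a * x ^ k) * (g x - b * x ^ l))
      \<in> O[at 0](\<lambda>x. x ^ Suc (k + l))"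
    by (intro sum_in_bigo) (simp_all add: power_add mult_ac)
  then show ?thesis by (simp add: algebra_simps power_add)
qed

lemma expands_mono:
  assumes "expands n f F" "m \<le> n"
  shows "expands m f F"
proof -
  have eq: "(\<Sum>i<n. F $ i * x ^ i) = (\<Sum>i<m. F $ i * x ^ i) + (\<Sum>i\<in>{m..<n}. F $ i * x ^ i)" for x
    using sum.atLeastLessThan_concat[of 0 m n "\<lambda>i. F $ i * x ^ i"] assms(2)
    by (simp add: atLeast0LessThan)
  have "(\<lambda>x. f x - (\<Sum>i<n. F $ i * x ^ i)) \<in> O[at 0](\<lambda>x. x ^ m)"
    using assms landau_o.big_trans[OF _ bigo_power_mono[of m n]] by (simp add: expands_def)
  moreover have "(\<lambda>x. \<Sum>i\<in>{m..<n}. F $ i * x ^ i) \<in> O[at 0](\<lambda>x. x ^ m)"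
    by (intro big_sum_in_bigo) (auto intro!: bigo_power_mono)
  ultimately have "(\<lambda>x. (f x - (\<Sum>i<n. F $ i * x ^ i)) + (\<Sum>i\<in>{m..<n}. F $ i * x ^ i))
      \<in> O[at 0](\<lambda>x. x ^ m)"
    by (rule sum_in_bigo)
  then show ?thesis by (simp add: eq expands_def)
qed

lemma expands_bigo:
  assumes "expands n f F" "k \<le> n" "\<And>i. i < k \<Longrightarrow> F $ i = 0"
  shows "f \<in> O[at 0](\<lambda>x. x ^ k)"
  using expands_mono[OF assms(1,2)] assms(3) by (simp add: expands_def)

lemma expands_ident: "n > 0 \<Longrightarrow> expands n (\<lambda>x. x) fps_X"
proof -
  assume "n > 0"
  show ?thesis
  proof (cases "n = 1")
    case True
    then show ?thesis by (simp add: expands_def)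
  next
    case False
    with \<open>n > 0\<close> have "(\<Sum>k<n. fps_X $ k * x ^ k) = x" for x :: real
      by (subst sum.remove[of _ 1]) (auto simp: fps_X_nth intro!: sum.neutral)
    then show ?thesis by (simp add: expands_def)
  qed
qed

lemma expands_power:
  assumes "expands n f F" "n > 0"
  shows "expands n (\<lambda>x. f x ^ i) (F ^ i)"
proof (induction i)
  case 0
  then show ?case using expands_const[OF assms(2), of 1] by simp
next
  case (Suc i)
  then show ?case using expands_mult[OF assms(1)] by simp
qed

lemma expands_sum:
  assumes "\<And>i. i < (m::nat) \<Longrightarrow> expands n (f i) (F i)" "n > 0"
  shows "expands n (\<lambda>x. \<Sum>i<m. f i x) (\<Sum>i<m. F i)"
  using assms(1)
proof (induction m)
  case 0
  then show ?case using expands_const[OF assms(2), of 0] by simp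
next
  case (Suc m)
  then show ?case by (simp add: expands_add)
qed

text \<open>As \<open>h\<close> has order \<open>j\<close>, the powers of \<open>h\<close> from
  \<open>m\<close> on are absorbed by \<open>O(x ^ n)\<close> once \<open>n \<le> j * m\<close>. The
  value of \<open>\<phi>\<close> at 0 is prescribed because \<open>h\<close> may vanish at nonzero
  points.\<close>

lemma expands_compose:
  assumes \<phi>: "expands m \<phi> \<Phi>" "\<phi> 0 = \<Phi> $ 0" "m > 0"
    and h: "expands n h F" "h \<in> O[at 0](\<lambda>x. x ^ j)" "j > 0" "n > 0" "n \<le> j * m"
  shows "expands n (\<lambda>x. \<phi> (h x)) (\<Sum>i<m. fps_const (\<Phi> $ i) * F ^ i)"
proof (rule expands_bigo_diff)
  show "expands n (\<lambda>x. \<Sum>i<m. \<Phi> $ i * h x ^ i) (\<Sum>i<m. fps_const (\<Phi> $ i) * F ^ i)"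
    using h by (intro expands_sum expands_mult expands_const expands_power)
  obtain C where C: "eventually (\<lambda>y. \<bar>\<phi> y - (\<Sum>i<m. \<Phi> $ i * y ^ i)\<bar> \<le> C * \<bar>y ^ m\<bar>) (at 0)"
    using \<phi>(1) unfolding expands_def by (auto elim: landau_o.bigE)
  have "(\<Sum>i<m. \<Phi> $ i * 0 ^ i) = \<Phi> $ 0"
    using \<phi>(3) by (subst sum.remove[of _ 0]) auto
  \<comment> \<open>At 0 both sides are 0, so the estimate extends from the punctured to the full
    neighbourhood, where \<open>h x = 0\<close> is allowed.\<close>
  with C have "eventually (\<lambda>y. \<bar>\<phi> y - (\<Sum>i<m. \<Phi> $ i * y ^ i)\<bar> \<le> C * \<bar>y ^ m\<bar>) (nhds 0)"
    using \<phi>(2,3) by (auto simp: eventually_nhds_conv_at zero_power)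
  moreover have "(h \<longlongrightarrow> 0) (at 0)"
  proof -
    have "((\<lambda>x::real. x ^ j / 1) \<longlongrightarrow> 0) (at 0)"
      using h(3) by (auto intro!: tendsto_eq_intros)
    then have "(\<lambda>x::real. x ^ j) \<in> o[at 0](\<lambda>_. 1)"
      by (intro smalloI_tendsto) auto
    then have "h \<in> o[at 0](\<lambda>_. 1)"
      using h(2) landau_o.big_small_trans by blast
    then show ?thesis by (auto dest: smalloD_tendsto)
  qed
  ultimately have "eventually (\<lambda>x. \<bar>\<phi> (h x) - (\<Sum>i<m. \<Phi> $ i * h x ^ i)\<bar> \<le> C * \<bar>h x ^ m\<bar>) (at 0)"
    by (rule eventually_compose_filterlim)
  then have "(\<lambda>x. \<phi> (h x) - (\<Sum>i<m. \<Phi> $ i * h x ^ i)) \<in> O[at 0](\<lambda>x. h x ^ m)"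
    by (intro bigoI) auto
  also have "(\<lambda>x. h x ^ m) \<in> O[at 0](\<lambda>x. (x ^ j) ^ m)"
    using h(2) by (rule landau_o.big_power)
  also have "(\<lambda>x::real. (x ^ j) ^ m) \<in> O[at 0](\<lambda>x. x ^ n)"
    using bigo_power_mono[OF h(5)] by (simp add: power_mult)
  finally show "(\<lambda>x. \<phi> (h x) - (\<Sum>i<m. \<Phi> $ i * h x ^ i)) \<in> O[at 0](\<lambda>x. x ^ n)" .
qed

section \<open>Coefficients of products and quotients of power series up to degree 4\<close>

lemma fps_divide_nth_rec:
  fixes A B :: "real fps"
  assumes "B $ 0 = 1"
  shows "(A / B) $ n = A $ n - (\<Sum>i<n. (A / B) $ i * B $ (n - i))"
proof -
  have "A / B * B = A"
    using assms by (simp add: fps_divide_unit mult.assoc inverse_mult_eq_1)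
  then have "A $ n = (\<Sum>i\<le>n. (A / B) $ i * B $ (n - i))"
    by (metis fps_mult_nth atLeast0AtMost)
  then show ?thesis
    using assms by (simp add: lessThan_Suc_atMost[symmetric])
qed

lemma fps_mult_nth_upto_4:
  fixes A B :: "'a::comm_semiring_1 fps"
  shows "(A * B) $ 0 = A $ 0 * B $ 0"
    and "(A * B) $ Suc 0 = A $ 0 * B $ Suc 0 + A $ Suc 0 * B $ 0"
    and "(A * B) $ 2 = A $ 0 * B $ 2 + A $ Suc 0 * B $ Suc 0 + A $ 2 * B $ 0"
    and "(A * B) $ 3 = A $ 0 * B $ 3 + A $ Suc 0 * B $ 2 + A $ 2 * B $ Suc 0 + A $ 3 * B $ 0"
    and "(A * B) $ 4 = A $ 0 * B $ 4 + A $ Suc 0 * B $ 3 + A $ 2 * B $ 2 + A $ 3 * B $ Suc 0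
      + A $ 4 * B $ 0"
  by (simp_all add: fps_mult_nth eval_nat_numeral)

text \<open>Comparing coefficients in \<open>A / B * B = A\<close> gives each coefficient of the
  quotient from the earlier ones, without computing an inverse. The constant coefficient 1 of
  \<open>B\<close> avoids all divisions.\<close>

lemma fps_divide_nth_upto_4:
  fixes A B :: "real fps"
  assumes "B $ 0 = 1"
  shows "(A / B) $ 0 = A $ 0"
    and "(A / B) $ Suc 0 = A $ Suc 0 - (A / B) $ 0 * B $ Suc 0"
    and "(A / B) $ 2 = A $ 2 - (A / B) $ 0 * B $ 2 - (A / B) $ Suc 0 * B $ Suc 0"
    and "(A / B) $ 3 = A $ 3 - (A / B) $ 0 * B $ 3 - (A / B) $ Suc 0 * B $ 2
      - (A / B) $ 2 * B $ Suc 0"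
    and "(A / B) $ 4 = A $ 4 - (A / B) $ 0 * B $ 4 - (A / B) $ Suc 0 * B $ 3
      - (A / B) $ 2 * B $ 2 - (A / B) $ 3 * B $ Suc 0"
  by (subst fps_divide_nth_rec[OF assms], simp add: eval_nat_numeral)+

section \<open>One step of the iteration\<close>

lemma less_4_cases: "i < 4 \<Longrightarrow> i = 0 \<or> i = Suc 0 \<or> i = 2 \<or> i = (3::nat)"
  by linarith

text \<open>The expansions depend on \<open>f\<close> only through \<open>\<phi>\<close> and
  \<open>\<psi>\<close>; \<open>f\<close> and its zero enter again in \<open>step_eq\<close>. The
  relation \<open>\<Psi>_nth\<close> reflects that \<open>\<psi>\<close> is the derivative of
  \<open>h * \<phi> h\<close>. The values of \<open>\<phi>\<close> and \<open>H\<close> at 0 are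
  fixed because both are composed with functions that may vanish.\<close>

locale normalized_step =
  fixes \<phi> \<psi> H :: "real \<Rightarrow> real" and \<Phi> \<Psi> :: "real fps"
  assumes expands_\<phi>: "expands 5 \<phi> \<Phi>"
    and expands_\<psi>: "expands 5 \<psi> \<Psi>"
    and expands_H: "expands 2 H (1 + 2 * fps_X)"
    and \<phi>_0 [simp]: "\<phi> 0 = 1"
    and H_0: "H 0 = 1"
    and \<Phi>_0 [simp]: "\<Phi> $ 0 = 1"
    and \<Psi>_nth: "\<And>k. \<Psi> $ k = real (Suc k) * \<Phi> $ k"
begin

text \<open>In the final application \<open>a\<close>, \<open>b\<close>, \<open>c\<close>,
  \<open>d\<close> are the error coefficients with index 2, 3, 4, 5.\<close>

abbreviation "a \<equiv> \<Phi> $ Suc 0"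
abbreviation "b \<equiv> \<Phi> $ 2"
abbreviation "c \<equiv> \<Phi> $ 3"
abbreviation "d \<equiv> \<Phi> $ 4"

text \<open>
  Functions of the error \<open>x = x\<^sub>n - xstar\<close>, where \<open>\<phi> h = f (xstar + h) / (f' xstar * h)\<close> and
  \<open>\<psi> h = f' (xstar + h) / f' xstar\<close>: the errors of \<open>y\<^sub>n\<close>, \<open>z\<^sub>n\<close> and \<open>x\<^sub>n\<^sub>+\<^sub>1\<close> are \<open>y\<close>, \<open>z\<close> and \<open>z * r\<close>,
  and \<open>t = f y\<^sub>n / f x\<^sub>n\<close>, \<open>m = f z\<^sub>n / f y\<^sub>n\<close>, \<open>s = f z\<^sub>n / f x\<^sub>n\<close>. Passing to \<open>m\<close> keeps the coefficients
  valid when \<open>c 2 = 0\<close>, where \<open>y\<^sub>n\<close> may hit the zero. Capital letters are the expansions of the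
  corresponding functions; only their coefficients up to degree 4 matter.
\<close>

definition "g x = (\<psi> x - \<phi> x) / \<psi> x"
definition "y x = x * g x"
definition "v x = \<phi> (y x)"
definition "t x = g x * v x / \<phi> x"
definition "q x = 1 - v x / \<psi> x * (1 / (1 - t x) + t x)"
definition "z x = y x * q x"
definition "w x = \<phi> (z x)"
definition "m x = q x * w x / v x"
definition "s x = m x * t x"
text \<open>This is \<open>weight_F\<close> times \<open>1 - m x\<close>, written in terms of the
  ratio \<open>t\<close>. Numerator and denominator are divided by 4 so that the denominator has
  constant coefficient 1.\<close>

definition "p x = (1 + t x + 1 / 4 * (t x * t x * (1 - 10 * t x))) / ((1 - 1 / 2 * t x) * (1 - 1 / 2 * t x))"
definition "r x = 1 - w x / \<psi> x * p x * (H (s x) / (1 - m x))"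

definition "G = (\<Psi> - \<Phi>) / \<Psi>"
definition "Y = fps_X * G"
text \<open>Three terms suffice for an error of \<open>O(x ^ 5)\<close> since \<open>y\<close> has
  order 2. Likewise two terms suffice in \<open>W\<close> and \<open>HS\<close>, where
  \<open>z\<close> has order 4 and \<open>s\<close> has order 3.\<close>

definition "V = (\<Sum>i<3. fps_const (\<Phi> $ i) * Y ^ i)"
definition "T = G * V / \<Phi>"
definition "Q = fps_const 1 - V / \<Psi> * (fps_const 1 / (fps_const 1 - T) + T)"
definition "Z = Y * Q"
definition "W = (\<Sum>i<2. fps_const (\<Phi> $ i) * Z ^ i)"
definition "M = Q * W / V"
definition "S = M * T"
definition "P = (fps_const 1 + T + fps_const (1 / 4) * (T * T * (fps_const 1 - fps_const 10 * T)))
  / ((fps_const 1 - fps_const (1 / 2) * T) * (fps_const 1 - fps_const (1 / 2) * T))"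
definition "HS = (\<Sum>i<2. fps_const ((1 + 2 * fps_X) $ i) * S ^ i)"
definition "R = fps_const 1 - W / \<Psi> * P * (HS / (fps_const 1 - M))"

section \<open>Coefficients up to degree 4 of the quantities of one step\<close>

lemma \<Psi>_0 [simp]: "\<Psi> $ 0 = 1"
  by (simp add: \<Psi>_nth)

lemmas nth_simps = fps_mult_nth_upto_4 fps_divide_nth_upto_4

lemma G_nth: "G $ 0 = 0" "G $ Suc 0 = a" "G $ 2 = 2 * b - 2 * a ^ 2"
  "G $ 3 = 4 * a ^ 3 + 3 * c - 7 * a * b"
  "G $ 4 = 20 * a ^ 2 * b + 4 * d - 8 * a ^ 4 - 10 * a * c - 6 * b ^ 2"
  by (simp_all add: G_def nth_simps \<Psi>_nth) algebra+

lemma Y_nth: "Y $ 0 = 0" "Y $ Suc 0 = 0" "Y $ 2 = a" "Y $ 3 = 2 * b - 2 * a ^ 2"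
  "Y $ 4 = 4 * a ^ 3 + 3 * c - 7 * a * b"
  by (simp_all add: Y_def nth_simps G_nth)

lemma V_nth: "V $ 0 = 1" "V $ Suc 0 = 0" "V $ 2 = a ^ 2" "V $ 3 = 2 * a * b - 2 * a ^ 3"
  "V $ 4 = 4 * a ^ 4 + 3 * a * c - 6 * a ^ 2 * b"
proof -
  have V_eq: "V = fps_const 1 + fps_const a * Y + fps_const b * (Y * Y)"
    by (simp add: V_def eval_nat_numeral)
  show "V $ 0 = 1" "V $ Suc 0 = 0" "V $ 2 = a ^ 2" "V $ 3 = 2 * a * b - 2 * a ^ 3"
    "V $ 4 = 4 * a ^ 4 + 3 * a * c - 6 * a ^ 2 * b"
    by (simp_all add: V_eq nth_simps Y_nth) algebra+
qed

lemma T_nth: "T $ 0 = 0" "T $ Suc 0 = a" "T $ 2 = 2 * b - 3 * a ^ 2"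
  "T $ 3 = 8 * a ^ 3 + 3 * c - 10 * a * b"
  "T $ 4 = 37 * a ^ 2 * b + 4 * d - 20 * a ^ 4 - 14 * a * c - 8 * b ^ 2"
  by (simp_all add: T_def nth_simps G_nth V_nth) algebra+

lemma V_div_\<Psi>_nth: "(V / \<Psi>) $ 0 = 1" "(V / \<Psi>) $ Suc 0 = - 2 * a"
  "(V / \<Psi>) $ 2 = 5 * a ^ 2 - 3 * b" "(V / \<Psi>) $ 3 = 14 * a * b - 12 * a ^ 3 - 4 * c"
  "(V / \<Psi>) $ 4 = 28 * a ^ 4 + 19 * a * c + 9 * b ^ 2 - 49 * a ^ 2 * b - 5 * d"
  by (simp_all add: nth_simps V_nth \<Psi>_nth) algebra+

lemma geometric_T_nth:
  defines "A \<equiv> fps_const 1 / (fps_const 1 - T)"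
  shows "A $ 0 = 1" "A $ Suc 0 = a" "A $ 2 = 2 * b - 2 * a ^ 2"
    "A $ 3 = 3 * a ^ 3 + 3 * c - 6 * a * b"
    "A $ 4 = 11 * a ^ 2 * b + 4 * d - 3 * a ^ 4 - 8 * a * c - 4 * b ^ 2"
  by (simp_all add: A_def nth_simps T_nth del: fps_const_1_eq_1) algebra+

text \<open>The vanishing of the first two coefficients makes \<open>z = y * q\<close> of order 4;
  the coefficient of degree 2 is the second factor of the error constant.\<close>

lemma Q_nth: "Q $ 0 = 0" "Q $ Suc 0 = 0" "Q $ 2 = 4 * a ^ 2 - b"
  "Q $ 3 = 16 * a * b - 19 * a ^ 3 - 2 * c"
  "Q $ 4 = 66 * a ^ 4 + 23 * a * c + 15 * b ^ 2 - 94 * a ^ 2 * b - 3 * d"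
  by (simp_all add: Q_def fps_mult_nth_upto_4 V_div_\<Psi>_nth geometric_T_nth T_nth del: fps_const_1_eq_1) algebra+

lemma Z_nth: "Z $ 0 = 0" "Z $ Suc 0 = 0" "Z $ 2 = 0" "Z $ 3 = 0" "Z $ 4 = 4 * a ^ 3 - a * b"
  by (simp_all add: Z_def nth_simps Y_nth Q_nth) algebra+

lemma W_nth: "W $ 0 = 1" "W $ Suc 0 = 0" "W $ 2 = 0" "W $ 3 = 0" "W $ 4 = 4 * a ^ 4 - a ^ 2 * b"
proof -
  have W_eq: "W = fps_const 1 + fps_const a * Z"
    by (simp add: W_def eval_nat_numeral)
  show "W $ 0 = 1" "W $ Suc 0 = 0" "W $ 2 = 0" "W $ 3 = 0" "W $ 4 = 4 * a ^ 4 - a ^ 2 * b"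
    by (simp_all add: W_eq nth_simps Z_nth) algebra+
qed

lemma M_nth: "M $ 0 = 0" "M $ Suc 0 = 0" "M $ 2 = 4 * a ^ 2 - b"
  "M $ 3 = 16 * a * b - 19 * a ^ 3 - 2 * c"
  "M $ 4 = 62 * a ^ 4 + 23 * a * c + 15 * b ^ 2 - 93 * a ^ 2 * b - 3 * d"
  by (simp_all add: M_def nth_simps Q_nth W_nth V_nth) algebra+

lemma S_nth: "S $ 0 = 0" "S $ Suc 0 = 0" "S $ 2 = 0" "S $ 3 = 4 * a ^ 3 - a * b"
  "S $ 4 = 27 * a ^ 2 * b - 31 * a ^ 4 - 2 * b ^ 2 - 2 * a * c"
  by (simp_all add: S_def nth_simps M_nth T_nth) algebra+

lemma P_nth: "P $ 0 = 1" "P $ Suc 0 = 2 * a" "P $ 2 = 4 * b - 4 * a ^ 2"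
  "P $ 3 = 3 * a ^ 3 + 6 * c - 12 * a * b"
  "P $ 4 = (35 / 2) * a ^ 4 + 4 * a ^ 2 * b + 8 * d - 16 * a * c - 8 * b ^ 2"
proof -
  define N where "N = fps_const 1 + T + fps_const (1 / 4) * (T * T * (fps_const 1 - fps_const 10 * T))"
  define B where "B = (fps_const 1 - fps_const (1 / 2) * T) * (fps_const 1 - fps_const (1 / 2) * T)"
  have N: "N $ 0 = 1" "N $ Suc 0 = a" "N $ 2 = 2 * b - (11 / 4) * a ^ 2"
    "N $ 3 = 4 * a ^ 3 + 3 * c - 9 * a * b"
    "N $ 4 = (35 / 4) * a ^ 4 + 14 * a ^ 2 * b + 4 * d - (25 / 2) * a * c - 7 * b ^ 2"
    by (simp_all add: N_def fps_mult_nth_upto_4 T_nth del: fps_const_1_eq_1) (simp add: field_simps power2_eq_square power3_eq_cube power4_eq_xxxx)+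
  have B: "B $ 0 = 1" "B $ Suc 0 = - a" "B $ 2 = (13 / 4) * a ^ 2 - 2 * b"
    "B $ 3 = 11 * a * b - (19 / 2) * a ^ 3 - 3 * c"
    "B $ 4 = (105 / 4) * a ^ 4 + (31 / 2) * a * c + 9 * b ^ 2 - 45 * a ^ 2 * b - 4 * d"
    by (simp_all add: B_def fps_mult_nth_upto_4 T_nth del: fps_const_1_eq_1) (simp add: field_simps power2_eq_square power3_eq_cube power4_eq_xxxx)+
  have P_eq: "P = N / B"
    by (simp add: P_def N_def B_def)
  show "P $ 0 = 1" "P $ Suc 0 = 2 * a" "P $ 2 = 4 * b - 4 * a ^ 2"
    "P $ 3 = 3 * a ^ 3 + 6 * c - 12 * a * b"
    "P $ 4 = (35 / 2) * a ^ 4 + 4 * a ^ 2 * b + 8 * d - 16 * a * c - 8 * b ^ 2"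
    by (simp_all add: P_eq fps_divide_nth_upto_4 N B) (simp add: field_simps power2_eq_square power3_eq_cube power4_eq_xxxx)+
qed

lemma W_div_\<Psi>_nth: "(W / \<Psi>) $ 0 = 1" "(W / \<Psi>) $ Suc 0 = - 2 * a"
  "(W / \<Psi>) $ 2 = 4 * a ^ 2 - 3 * b" "(W / \<Psi>) $ 3 = 12 * a * b - 8 * a ^ 3 - 4 * c"
  "(W / \<Psi>) $ 4 = 20 * a ^ 4 + 16 * a * c + 9 * b ^ 2 - 37 * a ^ 2 * b - 5 * d"
  by (simp_all add: nth_simps W_nth \<Psi>_nth) algebra+

lemma HS_nth: "HS $ 0 = 1" "HS $ Suc 0 = 0" "HS $ 2 = 0" "HS $ 3 = 8 * a ^ 3 - 2 * a * b"
  "HS $ 4 = 54 * a ^ 2 * b - 62 * a ^ 4 - 4 * b ^ 2 - 4 * a * c"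
proof -
  have "HS = fps_const 1 + fps_const 2 * S"
    by (simp add: HS_def eval_nat_numeral)
  then show "HS $ 0 = 1" "HS $ Suc 0 = 0" "HS $ 2 = 0" "HS $ 3 = 8 * a ^ 3 - 2 * a * b"
    "HS $ 4 = 54 * a ^ 2 * b - 62 * a ^ 4 - 4 * b ^ 2 - 4 * a * c"
    by (simp_all add: nth_simps S_nth)
qed

lemma HS_div_nth:
  defines "A \<equiv> HS / (fps_const 1 - M)"
  shows "A $ 0 = 1" "A $ Suc 0 = 0" "A $ 2 = 4 * a ^ 2 - b"
    "A $ 3 = 14 * a * b - 11 * a ^ 3 - 2 * c"
    "A $ 4 = 16 * a ^ 4 + 12 * b ^ 2 + 19 * a * c - 47 * a ^ 2 * b - 3 * d"
  by (simp_all add: A_def nth_simps HS_nth M_nth del: fps_const_1_eq_1) algebra+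

text \<open>The crucial cancellation: the weights make the product of \<open>W / \<Psi>\<close>,
  \<open>P\<close> and \<open>HS / (1 - M)\<close> equal to 1 up to degree 3. The slope 2 of
  \<open>H\<close> enters through \<open>HS\<close> and removes the term of degree 3. In degree 4
  the contributions -5, 8 and -3 of \<open>d\<close> cancel, so the fifth error coefficient does not
  appear in the error constant.\<close>

lemma R_nth: "R $ 0 = 0" "R $ Suc 0 = 0" "R $ 2 = 0" "R $ 3 = 0"
  "R $ 4 = 1 / 2 * a * (a ^ 3 - 8 * a * b + 2 * c)"
  by (simp_all add: R_def fps_mult_nth_upto_4 W_div_\<Psi>_nth P_nth HS_div_nth del: fps_const_1_eq_1)
    (simp add: field_simps power2_eq_square power3_eq_cube power4_eq_xxxx)+

lemma Y_nth_eq_0: "i < 2 \<Longrightarrow> Y $ i = 0" and Q_nth_eq_0: "i < 2 \<Longrightarrow> Q $ i = 0"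
  by (auto simp: less_2_cases_iff Y_nth Q_nth)

lemma
  shows Z_nth_eq_0: "i < 4 \<Longrightarrow> Z $ i = 0" and S_nth_eq_0: "i < 3 \<Longrightarrow> S $ i = 0"
    and R_nth_eq_0: "i < 4 \<Longrightarrow> R $ i = 0"
proof -
  show "i < 4 \<Longrightarrow> Z $ i = 0" "i < 4 \<Longrightarrow> R $ i = 0"
    using less_4_cases[of i] by (auto simp: Z_nth R_nth)
  show "i < 3 \<Longrightarrow> S $ i = 0"
    using less_4_cases[of i] by (auto simp: S_nth)
qed

section \<open>From formal series to the functions of one step\<close>

lemma
  shows expands_y: "expands 5 y Y" and expands_v: "expands 5 v V"
    and expands_t: "expands 5 t T" and expands_q: "expands 5 q Q" and expands_z: "expands 5 z Z"
    and expands_m: "expands 5 m M" and expands_r: "expands 5 r R"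
proof -
  note intros = expands_add expands_diff expands_mult expands_divide expands_const expands_ident
    expands_\<phi> expands_\<psi>
  have g: "expands 5 g G"
    unfolding g_def[abs_def] G_def by (intro intros) simp_all
  show y: "expands 5 y Y"
    unfolding y_def[abs_def] Y_def by (intro intros g) simp_all
  show v: "expands 5 v V"
    unfolding v_def[abs_def] V_def
  proof (rule expands_compose[where \<phi> = \<phi> and h = y])
    show "expands 3 \<phi> \<Phi>"
      using expands_mono[OF expands_\<phi>] by simp
    show "y \<in> O[at 0](\<lambda>x. x ^ 2)"
      by (rule expands_bigo[OF y]) (simp_all add: Y_nth_eq_0)
  qed (simp_all add: y)
  show t: "expands 5 t T"
    unfolding t_def[abs_def] T_def by (intro intros g v) simp_all
  show q: "expands 5 q Q"
    unfolding q_def[abs_def] Q_def by (intro intros t v) (simp_all add: T_nth)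
  show z: "expands 5 z Z"
    unfolding z_def[abs_def] Z_def by (intro intros y q)
  have w: "expands 5 w W"
    unfolding w_def[abs_def] W_def
  proof (rule expands_compose[where \<phi> = \<phi> and h = z])
    show "expands 2 \<phi> \<Phi>"
      using expands_mono[OF expands_\<phi>] by simp
    show "z \<in> O[at 0](\<lambda>x. x ^ 4)"
      by (rule expands_bigo[OF z]) (simp_all add: Z_nth_eq_0)
  qed (simp_all add: z)
  show m: "expands 5 m M"
    unfolding m_def[abs_def] M_def by (intro intros q w v) (simp_all add: V_nth)
  have s: "expands 5 s S"
    unfolding s_def[abs_def] S_def by (intro intros m t)
  have Hs: "expands 5 (\<lambda>x. H (s x)) HS"
    unfolding HS_def
  proof (rule expands_compose[where \<phi> = H and h = s])
    show "s \<in> O[at 0](\<lambda>x. x ^ 3)"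
      by (rule expands_bigo[OF s]) (simp_all add: S_nth_eq_0)
  qed (simp_all add: s expands_H H_0)
  have p: "expands 5 p P"
    unfolding p_def[abs_def] P_def by (intro intros t) (simp_all add: T_nth)
  show r: "expands 5 r R"
    unfolding r_def[abs_def] R_def by (intro intros w p Hs m) (simp_all add: M_nth)
qed

lemma step_leading_term:
  "(\<lambda>x. z x * r x - 1 / 2 * a ^ 2 * (4 * a ^ 2 - b) * (a ^ 3 - 8 * a * b + 2 * c) * x ^ 8)
    \<in> O[at 0](\<lambda>x. x ^ 9)"
proof -
  have "(\<lambda>x. y x - Y $ 2 * x ^ 2) \<in> O[at 0](\<lambda>x. x ^ Suc 2)"
    by (rule expands_leading_term[OF expands_y]) (simp_all add: Y_nth_eq_0)
  moreover have "(\<lambda>x. q x - Q $ 2 * x ^ 2) \<in> O[at 0](\<lambda>x. x ^ Suc 2)"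
    by (rule expands_leading_term[OF expands_q]) (simp_all add: Q_nth_eq_0)
  ultimately have "(\<lambda>x. z x - Y $ 2 * Q $ 2 * x ^ (2 + 2)) \<in> O[at 0](\<lambda>x. x ^ Suc (2 + 2))"
    unfolding z_def by (rule leading_term_mult)
  moreover have "(\<lambda>x. r x - R $ 4 * x ^ 4) \<in> O[at 0](\<lambda>x. x ^ Suc 4)"
    by (rule expands_leading_term[OF expands_r])
      (simp_all add: R_nth_eq_0)
  ultimately have "(\<lambda>x. z x * r x - (Y $ 2 * Q $ 2) * R $ 4 * x ^ (2 + 2 + 4))
      \<in> O[at 0](\<lambda>x. x ^ Suc (2 + 2 + 4))"
    by (rule leading_term_mult)
  moreover have "(Y $ 2 * Q $ 2) * R $ 4 =
      1 / 2 * a ^ 2 * (4 * a ^ 2 - b) * (a ^ 3 - 8 * a * b + 2 * c)"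
    by (simp add: Y_nth Q_nth R_nth power2_eq_square)
  ultimately show ?thesis
    by simp
qed

text \<open>Each condition follows from the limit of an expanded function at 0. The inequations are
  the nondegeneracy conditions of \<open>step_eq\<close>; the bounds keep the intermediate points in
  a ball around the zero.\<close>

lemma eventually_step_regular:
  assumes "\<rho> > 0"
  shows "eventually (\<lambda>x. \<phi> x \<noteq> 0 \<and> \<psi> x \<noteq> 0 \<and> v x \<noteq> 0 \<and> t x \<noteq> 1 \<and> t x \<noteq> 2 \<and> m x \<noteq> 1 \<and>
    \<bar>y x\<bar> < \<rho> \<and> \<bar>z x\<bar> < \<rho>) (at 0)"
proof -
  have lim: "(F \<longlongrightarrow> A $ 0) (at 0)" if "expands 5 F A" for F A
    using expands_tendsto[OF that] by simp
  have ne: "eventually (\<lambda>x. F x \<noteq> l) (at 0)" if "expands 5 F A" "A $ 0 \<noteq> l" for F A l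
    using tendsto_imp_eventually_ne[OF lim] that by blast
  have small: "eventually (\<lambda>x. \<bar>F x\<bar> < \<rho>) (at 0)" if "expands 5 F A" "A $ 0 = 0" for F A
    using tendstoD[OF lim[OF that(1)] assms] that(2) by (simp add: dist_real_def)
  show ?thesis
    by (intro eventually_conj ne[OF expands_\<phi>] ne[OF expands_\<psi>] ne[OF expands_v] ne[OF expands_t]
        ne[OF expands_m] small[OF expands_y] small[OF expands_z])
      (simp_all add: V_nth T_nth M_nth Y_nth Z_nth)
qed

text \<open>An exact identity at a fixed error \<open>e\<close>: dividing out \<open>A\<close>,
  \<open>e\<close> and \<open>f (xs + e)\<close> turns the iteration formulas into the functions
  above. No asymptotics are involved.\<close>

lemma step_eq:
  fixes f :: "real \<Rightarrow> real" and xs A e :: real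
  assumes f: "\<And>h. f (xs + h) = A * h * \<phi> h" and df: "deriv f (xs + e) = A * \<psi> e"
    and ne: "A \<noteq> 0" "e \<noteq> 0" "\<phi> e \<noteq> 0" "\<psi> e \<noteq> 0" "v e \<noteq> 0" "t e \<noteq> 1" "t e \<noteq> 2" "m e \<noteq> 1"
    and yn: "yn = xs + e - f (xs + e) / deriv f (xs + e)"
    and zn: "zn = xs + e + 1 / deriv f (xs + e) *
      (f (xs + e) ^ 2 / (f yn - f (xs + e)) - f yn ^ 2 / f (xs + e))"
    and xn': "xn' = zn - f zn / deriv f (xs + e) * weight_F f (xs + e) yn zn * H (f zn / f (xs + e))"
  shows "yn = xs + y e" and "zn = xs + z e" and "xn' = xs + z e * r e"
    and "yn = xs \<or> step_defined f (xs + e) yn zn"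
proof -
  define u where "u = f (xs + e)"
  have u: "u = A * e * \<phi> e" and "u \<noteq> 0"
    using ne by (simp_all add: u_def f)
  show y: "yn = xs + y e"
    using ne unfolding yn df f y_def g_def by (simp add: field_simps)
  have fy: "f yn = u * t e"
  proof -
    have "f yn = A * (e * g e) * v e"
      by (simp add: y f v_def y_def[symmetric] del: mult.assoc)
    then show ?thesis
      using ne by (simp add: u t_def)
  qed
  have "zn = xs + e + 1 / (A * \<psi> e) * (u ^ 2 / (u * t e - u) - (u * t e) ^ 2 / u)"
    unfolding zn fy df u_def[symmetric] ..
  also have "u ^ 2 / (u * t e - u) - (u * t e) ^ 2 / u = - u * (1 / (1 - t e) + t e ^ 2)"
    using \<open>u \<noteq> 0\<close> ne by (simp add: divide_simps power2_eq_square) algebra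
  \<comment> \<open>The identity \<open>1 / (1 - t) + t ^ 2 = 1 + t * (1 / (1 - t) + t)\<close>
    splits off the Newton step.\<close>
  also have "1 / (A * \<psi> e) * (- u * (1 / (1 - t e) + t e ^ 2)) =
      - (e * \<phi> e / \<psi> e) * (1 + t e * (1 / (1 - t e) + t e))"
    using ne by (simp add: u divide_simps power2_eq_square) algebra
  also have "xs + e + \<dots> = xs + (y e - (e * (t e * \<phi> e)) / \<psi> e * (1 / (1 - t e) + t e))"
    using ne by (simp add: y_def g_def field_simps)
  \<comment> \<open>After this exchange the correction contains \<open>e * g e\<close>, so the
    Newton error \<open>y e\<close> becomes a common factor.\<close>
  also have "t e * \<phi> e = g e * v e"
    using ne by (simp add: t_def)
  also have "y e - (e * (g e * v e)) / \<psi> e * (1 / (1 - t e) + t e) = z e"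
    by (simp add: z_def q_def y_def right_diff_distrib mult_ac)
  finally show z: "zn = xs + z e" .
  have fz': "f zn = A * z e * w e"
    unfolding z f w_def ..
  also have "\<dots> = m e * (A * y e * v e)"
    using ne by (simp add: z_def m_def)
  also have "A * y e * v e = f yn"
    by (simp add: y f v_def)
  finally have fz: "f zn = u * t e * m e"
    by (simp add: fy)
  show "yn = xs \<or> step_defined f (xs + e) yn zn"
  proof (cases "y e = 0")
    case False
    then have "t e \<noteq> 0"
      using ne by (simp add: t_def y_def)
    with ne \<open>u \<noteq> 0\<close> show ?thesis
      unfolding step_defined_def fy fz df u_def[symmetric] by auto
  qed (simp add: y)
  show "xn' = xs + z e * r e"
  proof (cases "t e = 0")
    \<comment> \<open>Here \<open>yn\<close> is already the zero and the denominator of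
      \<open>weight_F\<close> is 0. Its value is irrelevant, as it is multiplied by
      \<open>f zn = 0\<close>.\<close>
    case True
    then have "g e = 0"
      using ne by (simp add: t_def)
    then have "z e = 0"
      by (simp add: z_def y_def)
    moreover have "f zn = 0"
      by (simp add: fz True)
    ultimately show ?thesis
      using z by (simp add: xn')
  next
    case False
    \<comment> \<open>Numerator and denominator of \<open>weight_F\<close> share the factor
      \<open>u ^ 4 * t\<close>, which is nonzero in the present case.\<close>
    have num: "(u' * t') ^ 3 * (u' - 10 * (u' * t')) + 4 * u' ^ 2 * ((u' * t') ^ 2 + u' * (u' * t'))
        = u' ^ 4 * t' * (t' ^ 2 * (1 - 10 * t') + 4 * (1 + t'))" for u' t' :: real
      by (simp add: algebra_simps power2_eq_square power3_eq_cube power4_eq_xxxx)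
    have den: "u' * (2 * u' - u' * t') ^ 2 * (u' * t' - u' * t' * m')
        = u' ^ 4 * t' * ((2 - t') ^ 2 * (1 - m'))" for u' t' m' :: real
      by algebra
    have p: "p e = (t e ^ 2 * (1 - 10 * t e) + 4 * (1 + t e)) / (2 - t e) ^ 2"
    proof -
      have "p e = ((t e ^ 2 * (1 - 10 * t e) + 4 * (1 + t e)) / 4) / ((2 - t e) ^ 2 / 4)"
        unfolding p_def
        by (rule arg_cong2[where f = "(/)"]) (simp_all add: field_simps power2_eq_square)
      moreover have "(X / 4) / (Y / 4) = X / Y" for X Y :: real
        by simp
      ultimately show ?thesis by presburger
    qed
    have "u ^ 4 * t e \<noteq> 0"
      using False \<open>u \<noteq> 0\<close> by simp
    then have "weight_F f (xs + e) yn zn = p e / (1 - m e)"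
      unfolding weight_F_def fy fz u_def[symmetric] num den p
      by (simp only: mult_divide_mult_cancel_left divide_divide_eq_left not_False_eq_True)
    moreover have "f zn / f (xs + e) = s e"
      using \<open>u \<noteq> 0\<close> by (simp add: fz u_def[symmetric] s_def)
    moreover have "f zn / deriv f (xs + e) = z e * w e / \<psi> e"
      using ne by (simp add: fz' df)
    ultimately show ?thesis
      unfolding xn' z by (simp add: r_def algebra_simps)
  qed
qed

end

section \<open>Taylor expansion of the derivatives\<close>

text \<open>The Lagrange remainder involves \<open>g n\<close> at an intermediate point; continuity
  of \<open>g n\<close> at \<open>a\<close> bounds it by \<open>B\<close> nearby.\<close>

lemma taylor_bigo:
  fixes g :: "nat \<Rightarrow> real \<Rightarrow> real"
  assumes "\<rho> > 0" "n > 0"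
    and deriv: "\<And>k x. k < n \<Longrightarrow> x \<in> ball a \<rho> \<Longrightarrow> (g k has_real_derivative g (Suc k) x) (at x)"
    and cont: "isCont (g n) a"
  shows "(\<lambda>h. g 0 (a + h) - (\<Sum>k<n. g k a / fact k * h ^ k)) \<in> O[at 0](\<lambda>h. h ^ n)"
proof -
  define B where "B = \<bar>g n a\<bar> + 1"
  have "\<exists>\<sigma>>0. \<forall>x. dist x a < \<sigma> \<longrightarrow> dist (g n x) (g n a) < 1"
    using cont unfolding continuous_at_eps_delta by (metis zero_less_one)
  then obtain \<sigma> where \<sigma>: "\<sigma> > 0" "\<And>x. dist x a < \<sigma> \<Longrightarrow> dist (g n x) (g n a) < 1"
    by blast
  have "eventually (\<lambda>h::real. dist h 0 < min \<rho> \<sigma> \<and> h \<noteq> 0) (at 0)"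
    using \<open>\<rho> > 0\<close> \<sigma>(1) unfolding eventually_at by (intro exI[of _ "min \<rho> \<sigma>"]) auto
  then have "eventually (\<lambda>h. norm (g 0 (a + h) - (\<Sum>k<n. g k a / fact k * h ^ k)) \<le> B * norm (h ^ n)) (at 0)"
  proof eventually_elim
    case (elim h)
    have "\<exists>\<tau>. (if a + h < a then a + h < \<tau> \<and> \<tau> < a else a < \<tau> \<and> \<tau> < a + h) \<and>
        g 0 (a + h) = (\<Sum>k<n. g k a / fact k * (a + h - a) ^ k) + g n \<tau> / fact n * (a + h - a) ^ n"
    proof (rule Taylor[where a = "a - \<bar>h\<bar>" and b = "a + \<bar>h\<bar>"])
      show "\<forall>k \<tau>. k < n \<and> a - \<bar>h\<bar> \<le> \<tau> \<and> \<tau> \<le> a + \<bar>h\<bar> \<longrightarrow> (g k has_real_derivative g (Suc k) \<tau>) (at \<tau>)"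
        using elim by (auto intro!: deriv simp: dist_real_def)
    qed (use elim \<open>n > 0\<close> in auto)
    then obtain \<tau> where \<tau>: "\<bar>\<tau> - a\<bar> < \<bar>h\<bar>"
      and eq: "g 0 (a + h) = (\<Sum>k<n. g k a / fact k * h ^ k) + g n \<tau> / fact n * h ^ n"
      by (force split: if_splits)
    have "\<bar>g n \<tau>\<bar> \<le> B"
      using \<sigma>(2)[of \<tau>] \<tau> elim by (auto simp: dist_real_def B_def)
    moreover have "\<bar>g n \<tau>\<bar> / fact n \<le> \<bar>g n \<tau>\<bar> / 1"
      by (intro divide_left_mono) auto
    ultimately have "\<bar>g n \<tau>\<bar> / fact n \<le> B"
      by simp
    then have "\<bar>g n \<tau>\<bar> / fact n * \<bar>h ^ n\<bar> \<le> B * \<bar>h ^ n\<bar>"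
      by (rule mult_right_mono) simp
    then show ?case
      by (simp add: eq abs_mult)
  qed
  then show ?thesis by (rule bigoI)
qed

text \<open>Identifies the witness family of \<open>C_k_on\<close> with the iterated
  \<open>deriv\<close> in \<open>err_coeff\<close>. Openness matters because \<open>deriv\<close>
  refers to a full neighbourhood.\<close>

lemma higher_deriv_eq:
  fixes g :: "nat \<Rightarrow> real \<Rightarrow> real"
  assumes "open S" "\<And>x. x \<in> S \<Longrightarrow> g 0 x = f x"
    and "\<And>k x. k < n \<Longrightarrow> x \<in> S \<Longrightarrow> (g k has_real_derivative g (Suc k) x) (at x)"
  shows "k \<le> n \<Longrightarrow> x \<in> S \<Longrightarrow> (deriv ^^ k) f x = g k x"
proof (induction k arbitrary: x)
  case 0
  then show ?case using assms(2) by simp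
next
  case (Suc k)
  have "((deriv ^^ k) f has_real_derivative g (Suc k) x) (at x)"
  proof (rule has_field_derivative_transform_within_open)
    show "(g k has_real_derivative g (Suc k) x) (at x)"
      using assms(3) Suc.prems by simp
    show "g k x' = (deriv ^^ k) f x'" if "x' \<in> S" for x'
      using Suc.IH[OF _ that] Suc.prems by simp
  qed (use assms(1) Suc.prems in auto)
  then show ?case by (simp add: DERIV_imp_deriv)
qed


section \<open>The error equation\<close>

text \<open>The \<open>O(s ^ 2)\<close> remainder of \<open>H\<close> goes beyond what C1 regularity
  gives: since \<open>s\<close> has order 3, a remainder that is merely o(s) could contribute to
  \<open>r\<close> below order 4 and destroy order eight. Both \<open>\<delta>\<close> and
  \<open>K\<close> are uniform in the starting point. The exceptional alternatives in the second
  conjunct are the steps in which \<open>x n\<close> or \<open>y n\<close> hits the zero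
  exactly.\<close>

theorem theorem2p2p1:
  fixes f H :: "real \<Rightarrow> real" and D :: "real set" and xstar :: real
  assumes "is_interval D"
    and "C_k_on 8 f D"
    and "xstar \<in> interior D"
    and "simple_zero f xstar"
    and "H C1_differentiable_on UNIV"
    and "H 0 = 1"
    and "deriv H 0 = 2"
    and "(\<lambda>s. H s - (H 0 + deriv H 0 * s)) \<in> O[at 0](\<lambda>s. s ^ 2)"
  defines "c \<equiv> err_coeff f xstar"
  shows "\<exists>\<delta>>0. \<exists>K. \<forall>x y z.
    is_iteration f H x y z \<and> \<bar>x 0 - xstar\<bar> < \<delta> \<longrightarrow>
      (\<forall>n. {x n, y n, z n} \<subseteq> interior D) \<and>
      (\<forall>n. x n = xstar \<or> y n = xstar \<or> step_defined f (x n) (y n) (z n)) \<and>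
      x \<longlonglongrightarrow> xstar \<and>
      (\<forall>n. \<bar>(x (Suc n) - xstar) -
            (1 / 2 * c 2 ^ 2 * (4 * c 2 ^ 2 - c 3) * (c 2 ^ 3 - 8 * c 2 * c 3 + 2 * c 4))
              * (x n - xstar) ^ 8\<bar>
           \<le> K * \<bar>x n - xstar\<bar> ^ 9)"
proof -
  obtain \<rho> where \<rho>: "\<rho> > 0" "ball xstar \<rho> \<subseteq> interior D"
    using assms(3) open_contains_ball[of "interior D"] by auto
  have ball: "xstar + h \<in> ball xstar \<rho> \<longleftrightarrow> \<bar>h\<bar> < \<rho>" for h
    by (simp add: dist_real_def)
  obtain g where g0: "\<And>x. x \<in> D \<Longrightarrow> g 0 x = f x"
    and g_deriv: "\<And>k x. k < 8 \<Longrightarrow> x \<in> D \<Longrightarrow> (g k has_real_derivative g (Suc k) x) (at x within D)"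
    and g_cont: "\<And>k. k \<le> 8 \<Longrightarrow> continuous_on D (g k)"
    using assms(2) unfolding C_k_on_def by blast
  have inD: "x \<in> D" "at x within D = at x" if "x \<in> ball xstar \<rho>" for x
    using that \<rho>(2) interior_subset at_within_interior by (blast, blast)
  have g0': "g 0 x = f x" if "x \<in> ball xstar \<rho>" for x
    using g0 inD[OF that] by simp
  have deriv_g: "(g k has_real_derivative g (Suc k) x) (at x)" if "k < 8" "x \<in> ball xstar \<rho>" for k x
    using g_deriv[of k x] inD[OF that(2)] that(1) by simp
  have cont: "isCont (g k) xstar" if "k \<le> 8" for k
    using g_cont[OF that] inD[of xstar] \<rho>(1) by (auto simp: continuous_on_eq_continuous_within)
  have higher: "(deriv ^^ k) f x = g k x" if "k \<le> 8" "x \<in> ball xstar \<rho>" for k x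
    using higher_deriv_eq[OF open_ball g0' deriv_g] that by blast
  define A where "A = deriv f xstar"
  have "A \<noteq> 0" and f0: "f xstar = 0"
    using assms(4) by (simp_all add: simple_zero_def A_def)
  have deriv_f: "deriv f x = g 1 x" if "x \<in> ball xstar \<rho>" for x
    using higher[of 1 x] that by simp
  have A: "A = g 1 xstar"
    using deriv_f \<rho>(1) by (simp add: A_def)
  have c: "c k = g k xstar / (fact k * A)" if "k \<le> 8" for k
    using higher[OF that, of xstar] \<rho>(1) by (simp add: c_def err_coeff_def A_def)

  \<comment> \<open>The value 1 at 0 is the limit of the quotient, as \<open>A\<close> is the
    derivative at the zero.\<close>
  define \<phi> where "\<phi> h = (if h = 0 then 1 else f (xstar + h) / (A * h))" for h
  define \<psi> where "\<psi> h = deriv f (xstar + h) / A" for h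
  define \<Phi> where "\<Phi> = Abs_fps (\<lambda>k. g (Suc k) xstar / (fact (Suc k) * A))"
  define \<Psi> where "\<Psi> = Abs_fps (\<lambda>k. real (Suc k) * \<Phi> $ k)"
  have \<Phi>_c: "\<Phi> $ k = c (Suc k)" if "k < 8" for k
    using c[of "Suc k"] that by (simp add: \<Phi>_def)

  have near: "eventually (\<lambda>h::real. \<bar>h\<bar> < \<rho> \<and> h \<noteq> 0) (at 0)"
    using \<rho>(1) unfolding eventually_at by (intro exI[of _ \<rho>]) auto
  have exp_\<phi>: "expands 5 \<phi> \<Phi>"
  proof -
    \<comment> \<open>Taylor expansion to order 6, since the division by \<open>A * h\<close> costs
      one order and shifts the coefficients by one.\<close>
    have "(\<lambda>h. g 0 (xstar + h) - (\<Sum>k<6. g k xstar / fact k * h ^ k)) \<in> O[at 0](\<lambda>h. h ^ 6)"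
      by (rule taylor_bigo[OF \<rho>(1)]) (auto intro!: deriv_g cont)
    then have "(\<lambda>h. (g 0 (xstar + h) - (\<Sum>k<6. g k xstar / fact k * h ^ k)) * inverse (A * h))
        \<in> O[at 0](\<lambda>h. h ^ 6 * inverse h)"
      using \<open>A \<noteq> 0\<close> by (intro landau_o.big.mult) auto
    also have "?this \<longleftrightarrow> (\<lambda>h. \<phi> h - (\<Sum>k<5. \<Phi> $ k * h ^ k)) \<in> O[at 0](\<lambda>h. h ^ 5)"
    proof (rule landau_o.big.cong_ex)
      show "eventually (\<lambda>h. (g 0 (xstar + h) - (\<Sum>k<6. g k xstar / fact k * h ^ k)) * inverse (A * h)
          = \<phi> h - (\<Sum>k<5. \<Phi> $ k * h ^ k)) (at 0)"
        using near
      proof eventually_elim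
        case (elim h)
        have "(\<Sum>k<6. g k xstar / fact k * h ^ k) =
            g 0 xstar + (\<Sum>k<5. g (Suc k) xstar / fact (Suc k) * h ^ Suc k)"
          using sum.lessThan_Suc_shift[of "\<lambda>k. g k xstar / fact k * h ^ k" 5] by simp
        also have "g 0 xstar = 0"
          using g0' \<rho>(1) f0 by simp
        also have "(\<Sum>k<5. g (Suc k) xstar / fact (Suc k) * h ^ Suc k) =
            A * h * (\<Sum>k<5. \<Phi> $ k * h ^ k)"
          unfolding sum_distrib_left
          by (intro sum.cong refl) (use \<open>A \<noteq> 0\<close> in \<open>simp add: \<Phi>_def field_simps del: fact_Suc\<close>)
        finally show ?case
          using elim \<open>A \<noteq> 0\<close> g0'[of "xstar + h"] unfolding ball by (simp add: \<phi>_def field_simps)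
      qed
      show "eventually (\<lambda>h::real. h ^ 6 * inverse h = h ^ 5) (at 0)"
        using near by eventually_elim (simp add: power_Suc eval_nat_numeral)
    qed
    finally show ?thesis
      by (simp add: expands_def)
  qed
  have exp_\<psi>: "expands 5 \<psi> \<Psi>"
  proof -
    have "(\<lambda>h. g (Suc 0) (xstar + h) - (\<Sum>k<5. g (Suc k) xstar / fact k * h ^ k)) \<in> O[at 0](\<lambda>h. h ^ 5)"
      by (rule taylor_bigo[OF \<rho>(1), of _ _ "\<lambda>k. g (Suc k)"]) (auto intro!: deriv_g cont)
    then have "(\<lambda>h. inverse A * (g (Suc 0) (xstar + h) - (\<Sum>k<5. g (Suc k) xstar / fact k * h ^ k)))
        \<in> O[at 0](\<lambda>h. h ^ 5)"
      by simp
    also have "?this \<longleftrightarrow> (\<lambda>h. \<psi> h - (\<Sum>k<5. \<Psi> $ k * h ^ k)) \<in> O[at 0](\<lambda>h. h ^ 5)"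
    proof (rule landau_o.big.in_cong)
      show "eventually (\<lambda>h. inverse A * (g (Suc 0) (xstar + h) - (\<Sum>k<5. g (Suc k) xstar / fact k * h ^ k))
          = \<psi> h - (\<Sum>k<5. \<Psi> $ k * h ^ k)) (at 0)"
        using near
      proof eventually_elim
        case (elim h)
        have "inverse A * (\<Sum>k<5. g (Suc k) xstar / fact k * h ^ k) = (\<Sum>k<5. \<Psi> $ k * h ^ k)"
          unfolding sum_distrib_left \<Psi>_def \<Phi>_def
          by (intro sum.cong refl) (simp add: divide_inverse del: of_nat_Suc)
        then show ?case
          using elim deriv_f[of "xstar + h"] unfolding ball
          by (simp add: \<psi>_def right_diff_distrib divide_inverse mult.commute)
      qed
    qed
    finally show ?thesis
      by (simp add: expands_def)
  qed
  have exp_H: "expands 2 H (1 + 2 * fps_X)"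
    using assms(6-8) by (simp add: expands_def eval_nat_numeral)
  interpret normalized_step \<phi> \<psi> H \<Phi> \<Psi>
  proof
    show "\<Phi> $ 0 = 1"
      using A \<open>A \<noteq> 0\<close> by (simp add: \<Phi>_def)
  qed (use exp_\<phi> exp_\<psi> exp_H assms(6) in \<open>auto simp: \<phi>_def \<Psi>_def\<close>)

  define C where "C = 1 / 2 * c 2 ^ 2 * (4 * c 2 ^ 2 - c 3) * (c 2 ^ 3 - 8 * c 2 * c 3 + 2 * c 4)"
  have "\<Phi> $ Suc 0 = c 2" "\<Phi> $ 2 = c 3" "\<Phi> $ 3 = c 4"
    using \<Phi>_c[of 1] \<Phi>_c[of 2] \<Phi>_c[of 3] by (simp_all add: eval_nat_numeral)
  then have "(\<lambda>x. z x * r x - C * x ^ 8) \<in> O[at 0](\<lambda>x. x ^ 9)"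
    using step_leading_term by (simp add: C_def)
  then obtain K where "K > 0"
    and K: "eventually (\<lambda>x. \<bar>z x * r x - C * x ^ 8\<bar> \<le> K * \<bar>x ^ 9\<bar>) (at 0)"
    by (auto elim!: landau_o.bigE)
  \<comment> \<open>Factoring \<open>\<bar>e\<bar>\<close> out of the bound
    \<open>\<bar>C\<bar> * \<bar>e\<bar> ^ 8 + K * \<bar>e\<bar> ^ 9\<close> leaves this expression,
    so each step at least halves the error.\<close>
  have contracting: "eventually (\<lambda>x. \<bar>C\<bar> * \<bar>x\<bar> ^ 7 + K * \<bar>x\<bar> ^ 8 < 1 / 2) (at 0)"
    by (rule order_tendstoD) (auto intro!: tendsto_eq_intros)
  obtain \<delta>' where "\<delta>' > 0" and \<delta>': "\<And>e. e \<noteq> 0 \<Longrightarrow> \<bar>e\<bar> < \<delta>' \<Longrightarrow>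
      \<bar>e\<bar> < \<rho> \<and> (\<phi> e \<noteq> 0 \<and> \<psi> e \<noteq> 0 \<and> v e \<noteq> 0 \<and> t e \<noteq> 1 \<and> t e \<noteq> 2 \<and> m e \<noteq> 1 \<and> \<bar>y e\<bar> < \<rho> \<and> \<bar>z e\<bar> < \<rho>) \<and>
      \<bar>z e * r e - C * e ^ 8\<bar> \<le> K * \<bar>e ^ 9\<bar> \<and> \<bar>C\<bar> * \<bar>e\<bar> ^ 7 + K * \<bar>e\<bar> ^ 8 < 1 / 2"
    using eventually_conj[OF near eventually_conj[OF eventually_step_regular[OF \<rho>(1)]
        eventually_conj[OF K contracting]]]
    unfolding eventually_at by (auto simp: dist_real_def)
  define \<delta> where "\<delta> = min \<delta>' \<rho>"
  have "\<delta> > 0"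
    using \<open>\<delta>' > 0\<close> \<rho>(1) by (simp add: \<delta>_def)
  have f_eq: "f (xstar + h) = A * h * \<phi> h" for h
    using \<open>A \<noteq> 0\<close> f0 by (simp add: \<phi>_def)
  have df_eq: "deriv f (xstar + h) = A * \<psi> h" for h
    using \<open>A \<noteq> 0\<close> by (simp add: \<psi>_def)

  have step: "{xn, yn, zn} \<subseteq> interior D \<and> (xn = xstar \<or> yn = xstar \<or> step_defined f xn yn zn) \<and>
      \<bar>(xn' - xstar) - C * (xn - xstar) ^ 8\<bar> \<le> K * \<bar>xn - xstar\<bar> ^ 9 \<and>
      \<bar>xn' - xstar\<bar> \<le> \<bar>xn - xstar\<bar> / 2"
    if small: "\<bar>xn - xstar\<bar> < \<delta>"
      and yn: "yn = xn - f xn / deriv f xn"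
      and zn: "zn = xn + 1 / deriv f xn * (f xn ^ 2 / (f yn - f xn) - f yn ^ 2 / f xn)"
      and xn': "xn' = zn - f zn / deriv f xn * weight_F f xn yn zn * H (f zn / f xn)"
    for xn yn zn xn'
  proof (cases "xn = xstar")
    \<comment> \<open>At the zero itself the convention \<open>a / 0 = 0\<close> makes the iteration
      stationary.\<close>
    case True
    then have "yn = xstar"
      using yn f0 by simp
    moreover from this True have "zn = xstar"
      using zn f0 by simp
    moreover from this have "xn' = xstar"
      using xn' f0 by simp
    ultimately show ?thesis
      using True assms(3) by simp
  next
    case False
    define e where "e = xn - xstar"
    have xn: "xn = xstar + e" and "e \<noteq> 0" "\<bar>e\<bar> < \<delta>'"
      using False small by (auto simp: e_def \<delta>_def)
    note reg = \<delta>'[OF this(2,3)]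
    note eqs = step_eq[OF f_eq df_eq \<open>A \<noteq> 0\<close> \<open>e \<noteq> 0\<close> _ _ _ _ _ _ yn[unfolded xn] zn[unfolded xn] xn'[unfolded xn]]
    have y: "yn = xstar + y e" and z: "zn = xstar + z e" and x': "xn' = xstar + z e * r e"
      and defd: "yn = xstar \<or> step_defined f xn yn zn"
      using eqs reg unfolding xn by auto
    have err: "\<bar>z e * r e - C * e ^ 8\<bar> \<le> K * \<bar>e\<bar> ^ 9"
      using reg by (simp add: power_abs)
    have "\<bar>z e * r e\<bar> \<le> \<bar>C * e ^ 8\<bar> + K * \<bar>e\<bar> ^ 9"
      using err by linarith
    also have "\<dots> = (\<bar>C\<bar> * \<bar>e\<bar> ^ 7 + K * \<bar>e\<bar> ^ 8) * \<bar>e\<bar>"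
      by (simp add: abs_mult power_abs eval_nat_numeral algebra_simps)
    also have "\<dots> \<le> 1 / 2 * \<bar>e\<bar>"
      using reg by (intro mult_right_mono) auto
    finally have "\<bar>z e * r e\<bar> \<le> \<bar>e\<bar> / 2"
      by simp
    moreover have "{xn, yn, zn} \<subseteq> ball xstar \<rho>"
      using reg unfolding xn y z by (simp add: dist_real_def)
    ultimately show ?thesis
      using \<rho>(2) defd err unfolding x' e_def[symmetric] by auto
  qed

  show ?thesis
  proof (rule exI[of _ \<delta>], intro conjI \<open>\<delta> > 0\<close> exI[of _ K] allI impI)
    fix x y z :: "nat \<Rightarrow> real"
    assume "is_iteration f H x y z \<and> \<bar>x 0 - xstar\<bar> < \<delta>"
    then have it: "is_iteration f H x y z" and x0: "\<bar>x 0 - xstar\<bar> < \<delta>"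
      by auto
    have step': "{x n, y n, z n} \<subseteq> interior D \<and>
      (x n = xstar \<or> y n = xstar \<or> step_defined f (x n) (y n) (z n)) \<and>
      \<bar>(x (Suc n) - xstar) - C * (x n - xstar) ^ 8\<bar> \<le> K * \<bar>x n - xstar\<bar> ^ 9 \<and>
      \<bar>x (Suc n) - xstar\<bar> \<le> \<bar>x n - xstar\<bar> / 2" if "\<bar>x n - xstar\<bar> < \<delta>" for n
      using it that unfolding is_iteration_def by (intro step) blast+
    \<comment> \<open>The geometric decay and the invariant \<open>< \<delta>\<close> are proved
      together, because \<open>step'\<close> requires the invariant.\<close>
    have bound: "\<bar>x n - xstar\<bar> \<le> \<bar>x 0 - xstar\<bar> * (1 / 2) ^ n \<and> \<bar>x n - xstar\<bar> < \<delta>" for n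
    proof (induction n)
      case 0
      then show ?case using x0 by simp
    next
      case (Suc n)
      then have half: "\<bar>x (Suc n) - xstar\<bar> \<le> \<bar>x n - xstar\<bar> / 2"
        using step' by blast
      also have "\<dots> \<le> \<bar>x n - xstar\<bar>"
        by simp
      also have "\<dots> < \<delta>"
        using Suc.IH by blast
      finally have "\<bar>x (Suc n) - xstar\<bar> < \<delta>" .
      moreover have "\<bar>x (Suc n) - xstar\<bar> \<le> \<bar>x 0 - xstar\<bar> * (1 / 2) ^ n / 2"
        using half conjunct1[OF Suc.IH] by (meson divide_right_mono order_trans zero_le_numeral)
      ultimately show ?case
        by (simp only: power_Suc) (simp add: field_simps)
    qed
    note step'' = step'[OF conjunct2[OF bound]]
    show "{x n, y n, z n} \<subseteq> interior D" for n
      using step'' by blast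
    show "x n = xstar \<or> y n = xstar \<or> step_defined f (x n) (y n) (z n)" for n
      using step'' by blast
    show "\<bar>(x (Suc n) - xstar) -
            (1 / 2 * c 2 ^ 2 * (4 * c 2 ^ 2 - c 3) * (c 2 ^ 3 - 8 * c 2 * c 3 + 2 * c 4))
              * (x n - xstar) ^ 8\<bar>
           \<le> K * \<bar>x n - xstar\<bar> ^ 9" for n
      using step'' unfolding C_def by blast
    have "(\<lambda>n. x n - xstar) \<longlonglongrightarrow> 0"
    proof (rule Lim_null_comparison)
      show "eventually (\<lambda>n. norm (x n - xstar) \<le> \<bar>x 0 - xstar\<bar> * (1 / 2) ^ n) sequentially"
        unfolding real_norm_def by (intro always_eventually allI conjunct1[OF bound])
      show "(\<lambda>n. \<bar>x 0 - xstar\<bar> * (1 / 2) ^ n) \<longlonglongrightarrow> 0"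
        by (intro tendsto_mult_right_zero LIMSEQ_realpow_zero) auto
    qed
    then show "x \<longlonglongrightarrow> xstar"
      by (simp add: LIM_zero_iff)
  qed
qed

end
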